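(* Let $X$ and $Y$ be real or complex Banach spaces, not necessarily over the same field, and let $C$ be a closed, not necessarily proper, cone in $Y$. Let $T:C\to X$ be a surjective continuous additive positively homogeneous map. Furthermore, let $J$ be a finite set, possibly empty, and, for all $j\in J$, let $\rho_{j}:C\to\mathbb{R}$ be a continuous subadditive positively homogeneous map. Let $S_X:=\{x\in X:\|x\|=1\}$. If $K>0$ and $\alpha_{j}\in\mathbb{R}$ $(j\in J)$ are constants, then the following are equivalent: (1) For every $\varepsilon>0$, there exists a map $\gamma_{\varepsilon}:S_{X}\to C$ such that: (a) $T\circ\gamma_{\varepsilon}=\mathrm{id}_{S_{X}}$; (b) $\|\gamma_{\varepsilon}(x)\|\leq K+\varepsilon$ for all $x\in S_{X}$; (c) $\rho_{j}(\gamma_{\varepsilon}(x))\leq\alpha_{j}+\varepsilon$ for all $x\in S_{X}$ and $j\in J$. (2) For every $\varepsilon>0$, there exists a continuous positively homogeneous map $\gamma_{\varepsilon}:X\to C$ such that: (a) $T\circ\gamma_{\varepsilon}=\mathrm{id}_{X}$; (b) $\|\gamma_{\varepsilon}(x)\|\leq(K+\varepsilon)\|x\|$ for all $x\in X$; (c) $\rho_{j}(\gamma_{\varepsilon}(x))\leq(\alpha_{j}+\varepsilon)\|x\|$ for all $x\in X$ and $j\in J$.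
   Context: A subset $C$ of a real or complex vector space is a cone if $C+C\subseteq C$ and $\lambda C\subseteq C$ for all real $\lambda\geq 0$; it is proper if $C\cap(-C)=\{0\}$ (not assumed here). A map $T$ on a cone is additive if $T(u+v)=Tu+Tv$; a map $T$ on a cone or vector space is positively homogeneous if $T(\lambda u)=\lambda T(u)$ for all $u$ in its domain and all real $\lambda\geq0$; $\rho:C\to\mathbb{R}$ is subadditive if $\rho(u+v)\leq\rho(u)+\rho(v)$ for all $u,v\in C$. *)

theory Defs
  imports "HOL-Analysis.Analysis"
begin

text \<open>
  Real and complex Banach spaces are both represented by the class \<open>banach\<close>: a complex
  Banach space is an instance of it by restriction of scalars, with the same norm, and
  everything below refers to real scalars only. Maps defined on a subset are total
  functions of which only the values on that subset matter.
\<close>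

text \<open>
  Unlike \<open>cone\<close> of the library, this includes closure under addition; unlike
  \<open>convex_cone\<close>, the empty set is not excluded.
\<close>

definition additive_cone :: "'a::real_vector set \<Rightarrow> bool" where
  "additive_cone C \<longleftrightarrow>
     (\<forall>u\<in>C. \<forall>v\<in>C. u + v \<in> C) \<and> (\<forall>r\<ge>0. \<forall>u\<in>C. r *\<^sub>R u \<in> C)"

definition additive_on :: "'a::real_vector set \<Rightarrow> ('a \<Rightarrow> 'b::real_vector) \<Rightarrow> bool" where
  "additive_on C f \<longleftrightarrow> (\<forall>u\<in>C. \<forall>v\<in>C. f (u + v) = f u + f v)"

definition subadditive_on :: "'a::real_vector set \<Rightarrow> ('a \<Rightarrow> real) \<Rightarrow> bool" where
  "subadditive_on C f \<longleftrightarrow> (\<forall>u\<in>C. \<forall>v\<in>C. f (u + v) \<le> f u + f v)"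

definition pos_homogeneous_on :: "'a::real_vector set \<Rightarrow> ('a \<Rightarrow> 'b::real_vector) \<Rightarrow> bool" where
  "pos_homogeneous_on C f \<longleftrightarrow> (\<forall>u\<in>C. \<forall>r\<ge>0. f (r *\<^sub>R u) = r *\<^sub>R f u)"

end

theory Submission
  imports Defs
begin

text \<open>
  From the second condition to the first one restricts \<open>\<gamma>\<close> to the unit sphere. The other
  direction is a continuous selection problem, and the cone structure makes it possible to
  solve it with one continuous \<^emph>\<open>approximate\<close> right inverse of \<open>T\<close>.

  Let \<open>\<gamma>\<^sub>0\<close> be a possibly discontinuous right inverse of \<open>T\<close> on the unit sphere with the
  required bounds, and let \<open>\<delta> > 0\<close>. There is a continuous \<open>f\<close> on the sphere such that each
  \<open>f x\<close> lies in the closed convex hull of the values of \<open>\<gamma>\<^sub>0\<close> at points closer to \<open>x\<close> than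
  \<open>\<delta>\<close> (\<open>continuous_near_average\<close>). Every closed convex condition satisfied by these values
  passes to \<open>f x\<close>. The bounds on the norm and on the \<open>\<rho>\<^sub>j\<close> are of this kind because these
  functionals are convex and continuous, and so is membership in \<open>C\<close>. So is the condition
  that \<open>T\<close> takes a value within \<open>\<delta>\<close> of \<open>x\<close>, since \<open>T\<close> is continuous and preserves convex
  combinations. Extending \<open>f\<close> to \<open>F x = \<parallel>x\<parallel> f (x / \<parallel>x\<parallel>)\<close> yields a continuous positively
  homogeneous map into \<open>C\<close> with \<open>\<parallel>x - T (F x)\<parallel> \<le> \<delta> \<parallel>x\<parallel>\<close>
  (\<open>continuous_approximate_right_inverse\<close>).

  The error is then removed by iteration (\<open>approximate_right_inverse_iteration\<close>). With
  \<open>R x = x - T (F x)\<close>, the series \<open>\<gamma> x = F x + F (R x) + F (R (R x)) + \<dots>\<close> converges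
  geometrically and locally uniformly; its sum lies in the closed cone \<open>C\<close>, and the images
  under \<open>T\<close> of its partial sums telescope to \<open>x\<close>. All terms but the first are of total size
  \<open>O(\<delta>) \<parallel>x\<parallel>\<close>, so they spoil finitely many bounds by at most \<open>\<epsilon> / 2\<close> if \<open>\<delta>\<close> is small.

  The averaging step would usually be done with a partition of unity, that is, with
  paracompactness of metric spaces. Here a convergent series of bump functions, normalised by
  the sum of its weights, suffices. Well-order the sphere, and let \<open>\<sigma> x\<close> be the first point
  closer to \<open>x\<close> than \<open>\<delta>\<close>. On the set \<open>E\<^sub>n\<close> of points \<open>x\<close> closer to \<open>\<sigma> x\<close> than \<open>\<delta>\<close> by a margin
  of \<open>2\<^sup>-\<^sup>n\<close>, the map \<open>\<sigma>\<close> is constant at scale \<open>2\<^sup>-\<^sup>n\<close> (\<open>near_point_locally_constant\<close>). Hence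
  \<open>\<gamma>\<^sub>0 \<circ> \<sigma>\<close>, multiplied by a bump function concentrated near \<open>E\<^sub>n\<close>, is continuous, and the
  sets \<open>E\<^sub>n\<close> exhaust the sphere.
\<close>

section \<open>Infinite convex combinations\<close>

lemma continuous_on_suminf_M_test:
  fixes f :: "nat \<Rightarrow> 'a::topological_space \<Rightarrow> 'b::banach"
  assumes cont: "\<And>n. continuous_on A (f n)"
    and bound: "\<And>n x. x \<in> A \<Longrightarrow> norm (f n x) \<le> M n"
    and "summable M"
  shows "continuous_on A (\<lambda>x. \<Sum>n. f n x)"
proof (rule uniform_limit_theorem)
  show "uniform_limit A (\<lambda>n x. \<Sum>i<n. f i x) (\<lambda>x. \<Sum>n. f n x) sequentially"
    using bound \<open>summable M\<close> by (rule Weierstrass_m_test)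
  show "\<forall>\<^sub>F n in sequentially. continuous_on A (\<lambda>x. \<Sum>i<n. f i x)"
    by (intro always_eventually allI continuous_on_sum cont)
qed simp

text \<open>
  The limit of the finite convex combinations obtained from the partial sums, which have
  positive total weight from some index on. Points carrying weight \<open>0\<close> still have to be
  supplied from \<open>D\<close>; any will do.
\<close>

lemma closed_convex_suminf:
  fixes D :: "'a::real_normed_vector set"
  assumes "closed D" "convex D"
    and c: "\<And>n. c n \<ge> (0::real)" "c sums W" "W > 0"
    and v: "v sums V" "\<And>n. \<exists>d\<in>D. v n = c n *\<^sub>R d"
  shows "V /\<^sub>R W \<in> D"
proof -
  obtain d where d: "\<And>n. d n \<in> D" "\<And>n. v n = c n *\<^sub>R d n"
    using v(2) by metis
  have W: "(\<lambda>n. \<Sum>i<n. c i) \<longlonglongrightarrow> W" and V: "(\<lambda>n. \<Sum>i<n. v i) \<longlonglongrightarrow> V"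
    using c(2) v(1) by (simp_all add: sums_def)
  have lim: "(\<lambda>n. (\<Sum>i<n. v i) /\<^sub>R (\<Sum>i<n. c i)) \<longlonglongrightarrow> V /\<^sub>R W"
    using \<open>W > 0\<close> by (intro tendsto_intros V W) auto
  have "\<forall>\<^sub>F n in sequentially. (\<Sum>i<n. v i) /\<^sub>R (\<Sum>i<n. c i) \<in> D"
    using order_tendstoD(1)[OF W \<open>W > 0\<close>]
  proof eventually_elim
    case (elim n)
    have "(\<Sum>i<n. (c i / (\<Sum>i<n. c i)) *\<^sub>R d i) \<in> D"
      using elim c(1) d(1) \<open>convex D\<close>
      by (intro convex_sum) (auto simp flip: sum_divide_distrib)
    then show ?case
      by (simp add: d(2) scaleR_sum_right divide_inverse_commute)
  qed
  then show ?thesis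
    using \<open>closed D\<close> lim by (intro Lim_in_closed_set[of D _ sequentially]) auto
qed

section \<open>Continuous averages of an arbitrary map\<close>

text \<open>
  Take for \<open>\<sigma> x\<close> the first point, in some well-order, of the \<open>\<delta>\<close>-ball around \<open>x\<close>. If
  \<open>x\<close> and \<open>y\<close> are closer to each other than the margins left at both of them, then \<open>\<sigma> x\<close>
  competes for being \<open>\<sigma> y\<close> and vice versa, so neither precedes the other.
\<close>

lemma near_point_locally_constant:
  fixes S :: "'a::metric_space set"
  assumes "\<delta> > 0"
  obtains \<sigma> where "\<And>x. x \<in> S \<Longrightarrow> \<sigma> x \<in> S" "\<And>x. x \<in> S \<Longrightarrow> dist x (\<sigma> x) < \<delta>"
    "\<And>x y e. \<lbrakk>x \<in> S; y \<in> S; dist x (\<sigma> x) + e \<le> \<delta>; dist y (\<sigma> y) + e \<le> \<delta>; dist x y < e\<rbrakk>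
       \<Longrightarrow> \<sigma> x = \<sigma> y"
proof -
  obtain r :: "'a rel" where r: "well_order_on UNIV r"
    using well_order_on by blast
  then have wf: "wf (r - Id)" and tot: "total r"
    by (auto simp: well_order_on_def linear_order_on_def)
  have "\<exists>s. s \<in> S \<and> dist x s < \<delta> \<and> (\<forall>t. (t, s) \<in> r - Id \<longrightarrow> \<not> (t \<in> S \<and> dist x t < \<delta>))"
    if "x \<in> S" for x
    using wfE_min[OF wf, of x "{s \<in> S. dist x s < \<delta>}"] that assms by auto
  then obtain \<sigma> where \<sigma>: "\<And>x. x \<in> S \<Longrightarrow> \<sigma> x \<in> S \<and> dist x (\<sigma> x) < \<delta>"
    and min: "\<And>x t. \<lbrakk>x \<in> S; (t, \<sigma> x) \<in> r - Id\<rbrakk> \<Longrightarrow> \<not> (t \<in> S \<and> dist x t < \<delta>)"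
    by metis
  show ?thesis
  proof (rule that)
    fix x y e
    assume xy: "x \<in> S" "y \<in> S" "dist x (\<sigma> x) + e \<le> \<delta>" "dist y (\<sigma> y) + e \<le> \<delta>" "dist x y < e"
    have "dist y (\<sigma> x) < \<delta>" "dist x (\<sigma> y) < \<delta>"
      using xy dist_triangle[of y "\<sigma> x" x] dist_triangle[of x "\<sigma> y" y]
      by (auto simp: dist_commute)
    then have "(\<sigma> x, \<sigma> y) \<notin> r - Id" "(\<sigma> y, \<sigma> x) \<notin> r - Id"
      using min xy \<sigma> by blast+
    then show "\<sigma> x = \<sigma> y"
      using tot by (auto simp: total_on_def)
  qed (use \<sigma> in auto)
qed

text \<open>
  A map that is constant at scale \<open>e\<close> on \<open>E\<close> extends to the \<open>e / 3\<close>-neighbourhood of \<open>E\<close> by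
  taking the value at a nearby point of \<open>E\<close>, and the extension is locally constant. The weight
  \<open>w\<close> vanishes outside this neighbourhood; at its boundary the product with the weight stays
  continuous because the map is bounded.
\<close>

lemma locally_constant_cutoff_extension:
  fixes E :: "'a::metric_space set" and g :: "'a \<Rightarrow> 'b::real_normed_vector"
  assumes "e > 0"
    and const: "\<And>x y. \<lbrakk>x \<in> E; y \<in> E; dist x y < e\<rbrakk> \<Longrightarrow> g x = g y"
    and bound: "\<And>x. x \<in> E \<Longrightarrow> norm (g x) \<le> B"
  obtains w :: "'a \<Rightarrow> real" and h :: "'a \<Rightarrow> 'b"
  where "continuous_on UNIV w" "continuous_on UNIV h"
    "\<And>x. 0 \<le> w x" "\<And>x. w x \<le> 1" "\<And>x. x \<in> E \<Longrightarrow> w x = 1"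
    "\<And>x. w x = 0 \<and> h x = 0 \<or> (\<exists>c\<in>E. dist x c < e \<and> h x = w x *\<^sub>R g c)"
proof (cases "E = {}")
  case True
  show ?thesis
    by (rule that[of "\<lambda>_. 0" "\<lambda>_. 0"]) (use True in auto)
next
  case False
  define w where "w x = max 0 (1 - (3 / e) * infdist x E)" for x
  have w_cont: "continuous_on UNIV w"
    unfolding w_def by (intro continuous_intros)
  have w_pos: "w x > 0 \<longleftrightarrow> infdist x E < e / 3" for x
    using \<open>e > 0\<close> by (auto simp: w_def less_max_iff_disj field_simps)
  have "\<exists>c\<in>E. dist x c < e / 3" if "w x > 0" for x
    using that False unfolding w_pos infdist_notempty[OF False]
    by (subst (asm) cINF_less_iff) auto
  then obtain k where k: "\<And>x. w x > 0 \<Longrightarrow> k x \<in> E" "\<And>x. w x > 0 \<Longrightarrow> dist x (k x) < e / 3"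
    by metis
  define h where "h x = w x *\<^sub>R g (k x)" for x
  have w0: "w x \<ge> 0" for x
    by (simp add: w_def)
  have w_lim: "(w \<longlongrightarrow> w x) (at x)" for x
    using w_cont by (simp add: continuous_on_def)
  have "(h \<longlongrightarrow> h x) (at x)" for x
  proof (cases "w x > 0")
    case True
    \<comment> \<open>Three steps of length below \<open>e / 3\<close> join \<open>k y\<close> to \<open>k x\<close>.\<close>
    have same: "g (k y) = g (k x)" if "w y > 0" "dist y x < e / 3" for y
    proof (rule const)
      have "dist (k y) (k x) \<le> dist y (k y) + dist y x + dist x (k x)"
        using dist_triangle[of "k y" "k x" y] dist_triangle[of y "k x" x]
        by (simp add: dist_commute)
      then show "dist (k y) (k x) < e"
        using k(2)[OF that(1)] k(2)[OF True] that(2) by linarith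
    qed (use k that True in auto)
    have "\<forall>\<^sub>F y in at x. w y > 0"
      using w_lim True by (rule order_tendstoD)
    moreover have "\<forall>\<^sub>F y in at x. dist y x < e / 3"
      using tendstoD[OF tendsto_ident_at, of "e / 3" x UNIV] \<open>e > 0\<close> by simp
    ultimately have "\<forall>\<^sub>F y in at x. w y *\<^sub>R g (k x) = h y"
      by eventually_elim (simp add: h_def same)
    moreover have "((\<lambda>y. w y *\<^sub>R g (k x)) \<longlongrightarrow> h x) (at x)"
      unfolding h_def by (intro tendsto_intros w_lim)
    ultimately show ?thesis
      by (rule Lim_transform_eventually[rotated])
  next
    case False
    then have "w x = 0"
      using w0[of x] by simp
    have "norm (h y) \<le> w y * B" for y
      using bound[OF k(1), of y] w0[of y] by (cases "w y = 0") (auto simp: h_def mult_left_mono)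
    moreover have "((\<lambda>y. w y * B) \<longlongrightarrow> 0) (at x)"
      using tendsto_mult_right[OF w_lim[of x], of B] \<open>w x = 0\<close> by simp
    ultimately have "(h \<longlongrightarrow> 0) (at x)"
      by (intro Lim_null_comparison[of h "\<lambda>y. w y * B"]) auto
    then show ?thesis
      using \<open>w x = 0\<close> by (simp add: h_def)
  qed
  then have h_cont: "continuous_on UNIV h"
    by (simp add: continuous_on_def)
  show ?thesis
  proof (rule that[OF w_cont h_cont])
    fix x
    show "w x = 0 \<and> h x = 0 \<or> (\<exists>c\<in>E. dist x c < e \<and> h x = w x *\<^sub>R g c)"
    proof (cases "w x = 0")
      case False
      then have "w x > 0"
        using w0[of x] by simp
      then show ?thesis
        using k[of x] \<open>e > 0\<close> by (intro disjI2 bexI[of _ "k x"]) (auto simp: h_def)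
    qed (simp add: h_def)
  qed (use \<open>e > 0\<close> in \<open>auto simp: w_def infdist_nonneg\<close>)
qed

text \<open>
  This replaces a partition of unity subordinate to the balls of radius \<open>\<delta>\<close>. The weights
  \<open>w n\<close> need not be locally finite: the factors \<open>(1/2)^n\<close> make both series uniformly
  convergent, and the closure in the conclusion absorbs the passage to infinite convex
  combinations.
\<close>

lemma continuous_near_average:
  fixes S :: "'a::metric_space set" and \<gamma> :: "'a \<Rightarrow> 'b::banach"
  assumes "bounded (\<gamma> ` S)" and "\<delta> > 0"
  obtains f where "continuous_on S f"
    "\<And>x. x \<in> S \<Longrightarrow> f x \<in> closure (convex hull (\<gamma> ` (S \<inter> ball x \<delta>)))"
proof -
  obtain B where B: "\<And>x. x \<in> S \<Longrightarrow> norm (\<gamma> x) \<le> B"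
    using assms(1) by (auto simp: bounded_iff)
  obtain \<sigma> where \<sigma>: "\<And>x. x \<in> S \<Longrightarrow> \<sigma> x \<in> S" "\<And>x. x \<in> S \<Longrightarrow> dist x (\<sigma> x) < \<delta>"
    "\<And>x y e. \<lbrakk>x \<in> S; y \<in> S; dist x (\<sigma> x) + e \<le> \<delta>; dist y (\<sigma> y) + e \<le> \<delta>; dist x y < e\<rbrakk>
       \<Longrightarrow> \<sigma> x = \<sigma> y"
    using near_point_locally_constant[OF \<open>\<delta> > 0\<close>, of S] by metis
  define E where "E n = {x \<in> S. dist x (\<sigma> x) + (1/2)^n \<le> \<delta>}" for n :: nat
  have "\<exists>w h. continuous_on UNIV w \<and> continuous_on UNIV h \<and>
      (\<forall>x. 0 \<le> w x) \<and> (\<forall>x. w x \<le> (1::real)) \<and> (\<forall>x\<in>E n. w x = 1) \<and>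
      (\<forall>x. w x = 0 \<and> h x = 0 \<or>
        (\<exists>c\<in>E n. dist x c < (1/2)^n \<and> h x = w x *\<^sub>R \<gamma> (\<sigma> c)))" for n
    by (rule locally_constant_cutoff_extension[of "(1/2)^n" "E n" "\<lambda>x. \<gamma> (\<sigma> x)" B])
      (use \<sigma> B in \<open>auto simp: E_def\<close>, metis)
  then obtain w :: "nat \<Rightarrow> 'a \<Rightarrow> real" and h :: "nat \<Rightarrow> 'a \<Rightarrow> 'b"
    where cont: "\<And>n. continuous_on UNIV (w n)" "\<And>n. continuous_on UNIV (h n)"
      and w: "\<And>n x. 0 \<le> w n x" "\<And>n x. w n x \<le> 1" "\<And>n x. x \<in> E n \<Longrightarrow> w n x = 1"
      and h: "\<And>n x. w n x = 0 \<and> h n x = 0 \<or>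
        (\<exists>c\<in>E n. dist x c < (1/2)^n \<and> h n x = w n x *\<^sub>R \<gamma> (\<sigma> c))"
    by metis
  have h_bound: "norm (h n x) \<le> \<bar>B\<bar>" for n x
  proof -
    consider "h n x = 0" | c where "c \<in> E n" "h n x = w n x *\<^sub>R \<gamma> (\<sigma> c)"
      using h[of n x] by blast
    then show ?thesis
    proof cases
      case 2
      then have "norm (\<gamma> (\<sigma> c)) \<le> \<bar>B\<bar>"
        using B[OF \<sigma>(1), of c] by (auto simp: E_def)
      then have "w n x * norm (\<gamma> (\<sigma> c)) \<le> 1 * \<bar>B\<bar>"
        using w by (intro mult_mono) auto
      then show ?thesis
        using 2 w by simp
    qed simp
  qed
  have half: "summable (\<lambda>n. (1/2::real)^n)" "summable (\<lambda>n. (1/2::real)^n * \<bar>B\<bar>)"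
    by (intro summable_mult2 summable_geometric; simp)+
  define W where "W x = (\<Sum>n. (1/2)^n * w n x)" for x
  define F where "F x = (\<Sum>n. (1/2)^n *\<^sub>R h n x)" for x
  have W_bound: "norm ((1/2)^n * w n x) \<le> (1/2)^n" for n x
    using w(1,2)[where n = n and x = x] by (simp add: mult_left_le)
  have F_bound: "norm ((1/2)^n *\<^sub>R h n x) \<le> (1/2)^n * \<bar>B\<bar>" for n x
    using h_bound[of n x] by (simp add: mult_left_mono)
  have W_sums: "(\<lambda>n. (1/2)^n * w n x) sums W x" for x
    unfolding W_def using half(1) W_bound
    by (intro summable_sums summable_comparison_test'[OF half(1)])
  have F_sums: "(\<lambda>n. (1/2)^n *\<^sub>R h n x) sums F x" for x
    unfolding F_def using F_bound
    by (intro summable_sums summable_comparison_test'[OF half(2)])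
  have W_cont: "continuous_on UNIV W"
    unfolding W_def
    by (rule continuous_on_suminf_M_test[OF _ W_bound half(1)]) (intro continuous_intros cont)
  have F_cont: "continuous_on UNIV F"
    unfolding F_def
    by (rule continuous_on_suminf_M_test[OF _ F_bound half(2)]) (intro continuous_intros cont)
  have W_pos: "W x > 0" if "x \<in> S" for x
  proof -
    have "\<delta> - dist x (\<sigma> x) > 0"
      using \<sigma>(2)[OF that] by simp
    then obtain n where "(1/2)^n < \<delta> - dist x (\<sigma> x)"
      using real_arch_pow_inv[of "\<delta> - dist x (\<sigma> x)" "1/2"] by fastforce
    then have "w n x = 1"
      using that w(3) by (simp add: E_def)
    then show ?thesis
      unfolding W_def using w(1) W_sums
      by (intro suminf_pos2[of _ n]) (auto simp: sums_iff)
  qed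
  show ?thesis
  proof (rule that)
    show "continuous_on S (\<lambda>x. F x /\<^sub>R W x)"
      using W_pos by (intro continuous_intros continuous_on_subset[OF W_cont]
        continuous_on_subset[OF F_cont]) (auto simp: less_le)
    fix x assume "x \<in> S"
    let ?D = "closure (convex hull (\<gamma> ` (S \<inter> ball x \<delta>)))"
    have sub: "\<gamma> ` (S \<inter> ball x \<delta>) \<subseteq> ?D"
      by (meson closure_subset hull_subset subset_trans)
    have "\<exists>d\<in>?D. (1/2)^n *\<^sub>R h n x = ((1/2)^n * w n x) *\<^sub>R d" for n
    proof -
      consider "w n x = 0" "h n x = 0"
        | c where "c \<in> E n" "dist x c < (1/2)^n" "h n x = w n x *\<^sub>R \<gamma> (\<sigma> c)"
        using h[of n x] by blast
      then show ?thesis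
      proof cases
        case 1
        have "\<gamma> x \<in> ?D"
          using sub \<open>x \<in> S\<close> \<open>\<delta> > 0\<close> by auto
        then show ?thesis
          using 1 by auto
      next
        case 2
        \<comment> \<open>The margin \<open>(1/2)^n\<close> at \<open>c\<close> pays for moving from \<open>c\<close> to \<open>x\<close>.\<close>
        then have "dist x (\<sigma> c) < \<delta>" "\<sigma> c \<in> S"
          using dist_triangle[of x "\<sigma> c" c] \<sigma>(1) by (auto simp: E_def)
        then have "\<gamma> (\<sigma> c) \<in> ?D"
          using sub by auto
        then show ?thesis
          using 2 by auto
      qed
    qed
    then show "F x /\<^sub>R W x \<in> ?D"
      using W_sums F_sums w(1) W_pos[OF \<open>x \<in> S\<close>]
      by (intro closed_convex_suminf[where c = "\<lambda>n. (1/2)^n * w n x"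
            and v = "\<lambda>n. (1/2)^n *\<^sub>R h n x"])
        (auto intro: convex_closure)
  qed
qed

section \<open>Approximate right inverses\<close>

text \<open>
  Continuity at the origin is where boundedness on the sphere enters. The formula is also
  correct there, since division by \<open>norm 0\<close> is harmless under the factor \<open>0\<close>.
\<close>

lemma pos_homogeneous_extension:
  fixes f :: "'a::real_normed_vector \<Rightarrow> 'b::real_normed_vector"
  assumes cont: "continuous_on (sphere 0 1) f"
    and bound: "\<And>x. x \<in> sphere 0 1 \<Longrightarrow> norm (f x) \<le> B"
  shows "continuous_on UNIV (\<lambda>x. norm x *\<^sub>R f (x /\<^sub>R norm x))" (is "continuous_on _ ?F")
    and "pos_homogeneous_on UNIV (\<lambda>x. norm x *\<^sub>R f (x /\<^sub>R norm x))"
proof -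
  have "continuous_on (- {0}) ?F"
  proof -
    have "continuous_on (- {0}) (\<lambda>x::'a. f (x /\<^sub>R norm x))"
    proof (rule continuous_on_compose2[OF cont])
      show "continuous_on (- {0}) (\<lambda>x::'a. x /\<^sub>R norm x)"
        by (intro continuous_intros) auto
      show "(\<lambda>x::'a. x /\<^sub>R norm x) ` (- {0}) \<subseteq> sphere 0 1"
        by (rule image_subsetI) simp
    qed
    then show ?thesis
      by (intro continuous_intros)
  qed
  then have away: "isCont ?F x" if "x \<noteq> 0" for x
    using that by (simp add: continuous_on_eq_continuous_at open_Compl)
  have "(?F \<longlongrightarrow> 0) (at 0)"
  proof (rule Lim_null_comparison)
    have "norm (?F x) \<le> norm x * B" for x
      using bound[of "x /\<^sub>R norm x"] by (cases "x = 0") (auto simp: mult_left_mono)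
    then show "\<forall>\<^sub>F x in at 0. norm (?F x) \<le> norm x * B"
      by simp
    show "((\<lambda>x::'a. norm x * B) \<longlongrightarrow> 0) (at 0)"
      by (rule tendsto_eq_intros | simp)+
  qed
  then have "isCont ?F 0"
    by (simp add: isCont_def)
  show "continuous_on UNIV ?F"
  proof (rule continuous_at_imp_continuous_on, rule ballI)
    fix x :: 'a
    show "isCont ?F x"
    proof (cases "x = 0")
      case True
      show ?thesis
        unfolding True by (rule \<open>isCont ?F 0\<close>)
    qed (rule away)
  qed
  show "pos_homogeneous_on UNIV ?F"
    unfolding pos_homogeneous_on_def
  proof (intro ballI allI impI)
    fix u :: 'a and r :: real assume "r \<ge> 0"
    show "?F (r *\<^sub>R u) = r *\<^sub>R ?F u"
    proof (cases "r = 0")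
      case False
      then have "(r *\<^sub>R u) /\<^sub>R norm (r *\<^sub>R u) = u /\<^sub>R norm u"
        using \<open>r \<ge> 0\<close> by simp
      then show ?thesis
        using \<open>r \<ge> 0\<close> by (simp only: norm_scaleR abs_of_nonneg scaleR_scaleR)
    qed simp
  qed
qed

lemma convex_additive_cone:
  assumes "additive_cone C"
  shows "convex C"
  using assms by (auto simp: convex_def additive_cone_def)

lemma closed_convex_sublevel:
  fixes p :: "'a::real_normed_vector \<Rightarrow> real"
  assumes "closed C" "additive_cone C"
    and p: "continuous_on C p" "subadditive_on C p" "pos_homogeneous_on C p"
  shows "closed {y \<in> C. p y \<le> a}" "convex {y \<in> C. p y \<le> a}"
proof -
  have "convex_on C p"
  proof (rule convex_onI)
    show "convex C"
      using assms(2) by (rule convex_additive_cone)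
    fix t :: real and y z assume "0 < t" "t < 1" "y \<in> C" "z \<in> C"
    then show "p ((1 - t) *\<^sub>R y + t *\<^sub>R z) \<le> (1 - t) * p y + t * p z"
      using p(2,3) assms(2)
      by (smt (verit) additive_cone_def pos_homogeneous_on_def subadditive_on_def real_scaleR_def)
  qed
  then show "convex {y \<in> C. p y \<le> a}"
    unfolding convex_on_def convex_def
    by clarify (meson convex_bound_le order_trans)
  show "closed {y \<in> C. p y \<le> a}"
    using continuous_on_closed_Collect_le[OF p(1) continuous_on_const assms(1)] .
qed

lemma closed_convex_preimage_cball:
  fixes T :: "'a::real_normed_vector \<Rightarrow> 'b::real_normed_vector"
  assumes "closed C" "additive_cone C"
    and T: "continuous_on C T" "additive_on C T" "pos_homogeneous_on C T"
  shows "closed {y \<in> C. dist x (T y) \<le> \<delta>}" "convex {y \<in> C. dist x (T y) \<le> \<delta>}"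
proof -
  show "closed {y \<in> C. dist x (T y) \<le> \<delta>}"
    by (intro continuous_on_closed_Collect_le continuous_intros T assms(1))
  have *: "T (u *\<^sub>R y + v *\<^sub>R z) = u *\<^sub>R T y + v *\<^sub>R T z"
    if "y \<in> C" "z \<in> C" "u \<ge> 0" "v \<ge> 0" for u v y z
    using that T(2,3) assms(2)
    by (simp add: additive_cone_def additive_on_def pos_homogeneous_on_def)
  show "convex {y \<in> C. dist x (T y) \<le> \<delta>}"
  proof (rule convexI)
    fix y z :: 'a and u v :: real
    assume yz: "y \<in> {y \<in> C. dist x (T y) \<le> \<delta>}" "z \<in> {y \<in> C. dist x (T y) \<le> \<delta>}"
      and uv: "0 \<le> u" "0 \<le> v" "u + v = 1"
    have "u *\<^sub>R y + v *\<^sub>R z \<in> C"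
      using convexD[OF convex_additive_cone[OF assms(2)]] yz uv by blast
    moreover have "u *\<^sub>R T y + v *\<^sub>R T z \<in> cball x \<delta>"
      using yz uv by (intro convexD[OF convex_cball]) auto
    ultimately show "u *\<^sub>R y + v *\<^sub>R z \<in> {y \<in> C. dist x (T y) \<le> \<delta>}"
      using *[of y z u v] yz uv by simp
  qed
qed

text \<open>
  The homogeneous extension of a continuous average of \<open>\<gamma>\<close>. The functionals \<open>p\<close> are
  quantified in the conclusion because one \<open>F\<close> has to respect the norm and all \<open>\<rho> j\<close> at once.
\<close>

lemma continuous_approximate_right_inverse:
  fixes C :: "'y::banach set" and T :: "'y \<Rightarrow> 'x::banach"
  assumes C: "closed C" "additive_cone C"
    and T: "continuous_on C T" "additive_on C T" "pos_homogeneous_on C T"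
    and "0 \<in> C" "\<delta> > 0"
    and \<gamma>: "\<And>x. x \<in> sphere 0 1 \<Longrightarrow> \<gamma> x \<in> C" "\<And>x. x \<in> sphere 0 1 \<Longrightarrow> T (\<gamma> x) = x"
      "bounded (\<gamma> ` sphere 0 1)"
  obtains F where "range F \<subseteq> C" "continuous_on UNIV F" "pos_homogeneous_on UNIV F"
    "\<And>x. norm (x - T (F x)) \<le> \<delta> * norm x"
    "\<And>p a x. \<lbrakk>continuous_on C p; subadditive_on C p; pos_homogeneous_on C p;
        \<And>x. x \<in> sphere 0 1 \<Longrightarrow> p (\<gamma> x) \<le> a\<rbrakk> \<Longrightarrow> p (F x) \<le> a * norm x"
proof -
  let ?S = "sphere (0::'x) 1"
  obtain f where f_cont: "continuous_on ?S f"
    and f: "\<And>x. x \<in> ?S \<Longrightarrow> f x \<in> closure (convex hull (\<gamma> ` (?S \<inter> ball x \<delta>)))"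
    using continuous_near_average[OF \<gamma>(3) \<open>\<delta> > 0\<close>] by metis
  have fD: "f x \<in> D" if "x \<in> ?S" "closed D" "convex D" "\<gamma> ` (?S \<inter> ball x \<delta>) \<subseteq> D" for x D
    using f[OF that(1)] closure_minimal[OF hull_minimal[where S = convex]] that by blast
  have fC: "f x \<in> C" if "x \<in> ?S" for x
    using that C convex_additive_cone \<gamma>(1) by (intro fD[of x C]) auto
  have fp: "p (f x) \<le> a" if p: "continuous_on C p" "subadditive_on C p" "pos_homogeneous_on C p"
    and "\<And>x. x \<in> ?S \<Longrightarrow> p (\<gamma> x) \<le> a" and "x \<in> ?S" for p a x
    using fD[OF \<open>x \<in> ?S\<close> closed_convex_sublevel[OF C p, of a]] that(4) \<gamma>(1)
    by (auto simp: image_subset_iff)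
  have fT: "dist x (T (f x)) \<le> \<delta>" if "x \<in> ?S" for x
    using fD[OF \<open>x \<in> ?S\<close> closed_convex_preimage_cball[OF C T, of x \<delta>]] \<gamma>(1,2)
    by (auto simp: image_subset_iff)
  obtain B where "\<And>x. x \<in> ?S \<Longrightarrow> norm (\<gamma> x) \<le> B"
    using \<gamma>(3) unfolding bounded_iff by blast
  then have fB: "norm (f x) \<le> B" if "x \<in> ?S" for x
    by (intro fp[of norm B x] that)
      (auto simp: subadditive_on_def pos_homogeneous_on_def norm_triangle_ineq
        intro: continuous_intros)
  define F where "F x = norm x *\<^sub>R f (x /\<^sub>R norm x)" for x
  have unit: "x /\<^sub>R norm x \<in> ?S" if "x \<noteq> 0" for x
    using that by simp
  show ?thesis
  proof (rule that)
    show "range F \<subseteq> C"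
    proof clarsimp
      fix x show "F x \<in> C"
        using fC[OF unit[of x]] C(2) \<open>0 \<in> C\<close>
        by (cases "x = 0") (auto simp: F_def additive_cone_def)
    qed
    show "continuous_on UNIV F" "pos_homogeneous_on UNIV F"
      unfolding F_def using pos_homogeneous_extension[OF f_cont fB] by auto
    have hom0: "p 0 = 0" if "pos_homogeneous_on C p" for p :: "'y \<Rightarrow> 'z::real_vector"
      using that \<open>0 \<in> C\<close> unfolding pos_homogeneous_on_def by (metis order_refl scaleR_zero_left)
    have scale: "p (F x) = norm x *\<^sub>R p (f (x /\<^sub>R norm x))"
      if "pos_homogeneous_on C p" "x \<noteq> 0" for p :: "'y \<Rightarrow> 'z::real_vector" and x
      using that fC[OF unit[of x]] by (simp add: F_def pos_homogeneous_on_def)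
    show "norm (x - T (F x)) \<le> \<delta> * norm x" for x
    proof (cases "x = 0")
      case True
      then show ?thesis
        by (simp add: F_def hom0[OF T(3)])
    next
      case False
      then have "x - T (F x) = norm x *\<^sub>R (x /\<^sub>R norm x - T (f (x /\<^sub>R norm x)))"
        by (simp add: scale[OF T(3)] scaleR_diff_right)
      then have "norm (x - T (F x)) = norm x * dist (x /\<^sub>R norm x) (T (f (x /\<^sub>R norm x)))"
        by (simp add: dist_norm)
      also have "\<dots> \<le> norm x * \<delta>"
        using fT[OF unit[OF False]] by (intro mult_left_mono) auto
      finally show ?thesis
        by (simp add: mult.commute)
    qed
    fix p :: "'y \<Rightarrow> real" and a x
    assume p: "continuous_on C p" "subadditive_on C p" "pos_homogeneous_on C p"
      and le: "\<And>x. x \<in> ?S \<Longrightarrow> p (\<gamma> x) \<le> a"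
    show "p (F x) \<le> a * norm x"
    proof (cases "x = 0")
      case True
      then show ?thesis
        by (simp add: F_def hom0[OF p(3)])
    next
      case False
      have "norm x * p (f (x /\<^sub>R norm x)) \<le> norm x * a"
        using fp[OF p le unit[OF False]] by (intro mult_left_mono) auto
      then show ?thesis
        using scale[OF p(3) False] by (simp add: mult.commute)
    qed
  qed
qed

section \<open>From approximate to exact right inverses\<close>

text \<open>
  The sum of the series \<open>F x + F (R x) + F (R (R x)) + \<dots>\<close> of successive corrections, where
  \<open>R x = x - T (F x)\<close> is the remaining error. Estimating \<open>p\<close> term by term only yields the
  constant \<open>\<bar>a\<bar> / (1 - \<delta>)\<close>, which does not tend to \<open>a\<close> as \<open>\<delta>\<close> tends to \<open>0\<close> if \<open>a < 0\<close>. So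
  this crude estimate is applied to the tail alone: \<open>\<gamma> x = F x + \<gamma> (R x)\<close>, with
  \<open>norm (R x) \<le> \<delta> * norm x\<close>.
\<close>

lemma approximate_right_inverse_iteration:
  fixes C :: "'y::banach set" and T :: "'y \<Rightarrow> 'x::banach" and F :: "'x \<Rightarrow> 'y"
  assumes C: "closed C" "additive_cone C"
    and T: "continuous_on C T" "additive_on C T" "pos_homogeneous_on C T"
    and F: "range F \<subseteq> C" "continuous_on UNIV F" "pos_homogeneous_on UNIV F"
      "\<And>x. norm (F x) \<le> M * norm x"
    and err: "\<And>x. norm (x - T (F x)) \<le> \<delta> * norm x"
    and \<delta>: "0 \<le> \<delta>" "\<delta> < 1"
  obtains \<gamma> where "range \<gamma> \<subseteq> C" "continuous_on UNIV \<gamma>" "pos_homogeneous_on UNIV \<gamma>"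
    "\<And>x. T (\<gamma> x) = x"
    "\<And>p a x. \<lbrakk>continuous_on C p; subadditive_on C p; pos_homogeneous_on C p;
        \<And>x. p (F x) \<le> a * norm x\<rbrakk>
      \<Longrightarrow> p (\<gamma> x) \<le> (a + \<bar>a\<bar> * \<delta> / (1 - \<delta>)) * norm x"
proof -
  define R where "R x = x - T (F x)" for x
  define \<gamma> where "\<gamma> x = (\<Sum>n. F ((R ^^ n) x))" for x
  have FC: "F x \<in> C" for x
    using F(1) by auto
  have "0 \<in> C"
    using C(2) FC[of 0] unfolding additive_cone_def by (metis order_refl scaleR_zero_left)
  have zero: "p 0 = 0" if "pos_homogeneous_on C p" for p :: "'y \<Rightarrow> 'z::real_vector"
    using that \<open>0 \<in> C\<close> unfolding pos_homogeneous_on_def by (metis order_refl scaleR_zero_left)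
  have R_cont: "continuous_on UNIV (R ^^ n)" for n
  proof (induction n)
    case (Suc n)
    have "continuous_on UNIV R"
      unfolding R_def
      by (intro continuous_intros continuous_on_compose2[OF T(1) F(2)]) (use FC in auto)
    then show ?case
      using Suc by (simp add: comp_def continuous_on_compose2)
  qed (simp add: id_def)
  have R_hom: "(R ^^ n) (r *\<^sub>R x) = r *\<^sub>R (R ^^ n) x" if "r \<ge> 0" for n r x
  proof (induction n)
    case (Suc n)
    then show ?case
      using F(3) T(3) FC that by (simp add: R_def pos_homogeneous_on_def scaleR_diff_right)
  qed simp
  have R_norm: "norm ((R ^^ n) x) \<le> \<delta> ^ n * norm x" for n x
  proof (induction n)
    case (Suc n)
    have "norm ((R ^^ Suc n) x) \<le> \<delta> * norm ((R ^^ n) x)"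
      using err by (simp add: R_def)
    also have "\<dots> \<le> \<delta> * (\<delta> ^ n * norm x)"
      using Suc \<delta> by (intro mult_left_mono)
    finally show ?case
      by (simp add: mult.assoc)
  qed simp
  have geo: "summable (\<lambda>n. \<delta> ^ n)"
    using \<delta> by (intro summable_geometric) simp
  have term_bound: "norm (F ((R ^^ n) x)) \<le> \<bar>M\<bar> * norm x * \<delta> ^ n" for n x
  proof -
    have "norm (F ((R ^^ n) x)) \<le> M * norm ((R ^^ n) x)"
      by (rule F(4))
    also have "\<dots> \<le> \<bar>M\<bar> * (\<delta> ^ n * norm x)"
      using R_norm[of n x] by (intro mult_mono) auto
    finally show ?thesis
      by (simp add: mult_ac)
  qed
  have summ: "summable (\<lambda>n. F ((R ^^ n) x))" for x
    by (rule summable_comparison_test'[OF summable_mult[OF geo]]) (rule term_bound)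
  then have lim: "(\<lambda>n. \<Sum>i<n. F ((R ^^ i) x)) \<longlonglongrightarrow> \<gamma> x" for x
    unfolding \<gamma>_def by (rule summable_LIMSEQ)
  have partC: "(\<Sum>i<n. F ((R ^^ i) x)) \<in> C" for n x
    by (induction n) (use C(2) FC \<open>0 \<in> C\<close> in \<open>auto simp: additive_cone_def\<close>)
  have \<gamma>C: "\<gamma> x \<in> C" for x
    by (rule closed_sequentially[OF C(1) partC lim])
  have along: "(\<lambda>n. p (\<Sum>i<n. F ((R ^^ i) x))) \<longlonglongrightarrow> p (\<gamma> x)"
    if "continuous_on C p" for p :: "'y \<Rightarrow> 'z::topological_space" and x
    using that lim \<gamma>C by (rule continuous_on_tendsto_compose) (simp add: partC)
  have split: "\<gamma> x = F x + \<gamma> (R x)" for x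
    using suminf_split_head[OF summ[of x]] by (simp add: \<gamma>_def funpow_Suc_right del: funpow.simps)

  show ?thesis
  proof (rule that)
    show "range \<gamma> \<subseteq> C"
      using \<gamma>C by auto
    show "continuous_on UNIV \<gamma>"
    proof (rule continuous_at_imp_continuous_on, rule ballI)
      fix x :: 'x
      have "continuous_on (ball 0 (norm x + 1)) \<gamma>"
        unfolding \<gamma>_def
      proof (rule continuous_on_suminf_M_test)
        show "continuous_on (ball 0 (norm x + 1)) (\<lambda>y. F ((R ^^ n) y))" for n
          by (rule continuous_on_compose2[OF F(2) continuous_on_subset[OF R_cont]]) auto
        show "norm (F ((R ^^ n) y)) \<le> \<bar>M\<bar> * (norm x + 1) * \<delta> ^ n"
          if "y \<in> ball 0 (norm x + 1)" for n y
          using that \<delta>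
          by (intro order_trans[OF term_bound] mult_right_mono mult_left_mono) auto
        show "summable (\<lambda>n. \<bar>M\<bar> * (norm x + 1) * \<delta> ^ n)"
          by (rule summable_mult[OF geo])
      qed
      then show "isCont \<gamma> x"
        by (simp add: continuous_on_eq_continuous_at)
    qed
    show "pos_homogeneous_on UNIV \<gamma>"
      using F(3) summ
      by (auto simp: pos_homogeneous_on_def \<gamma>_def R_hom suminf_scaleR_right)
    show "T (\<gamma> x) = x" for x
    proof -
      have "T (\<Sum>i<n. F ((R ^^ i) x)) = x - (R ^^ n) x" for n
      proof (induction n)
        case (Suc n)
        have "T ((\<Sum>i<n. F ((R ^^ i) x)) + F ((R ^^ n) x))
            = T (\<Sum>i<n. F ((R ^^ i) x)) + T (F ((R ^^ n) x))"
          using T(2) partC FC unfolding additive_on_def by blast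
        with Suc show ?case
          by (simp add: R_def[of "(R ^^ n) x"])
      qed (simp add: zero[OF T(3)])
      then have "(\<lambda>n. x - (R ^^ n) x) \<longlonglongrightarrow> T (\<gamma> x)"
        using along[OF T(1), of x] by simp
      moreover have "(\<lambda>n. (R ^^ n) x) \<longlonglongrightarrow> 0"
      proof (rule Lim_null_comparison)
        show "\<forall>\<^sub>F n in sequentially. norm ((R ^^ n) x) \<le> \<delta> ^ n * norm x"
          using R_norm by simp
        show "(\<lambda>n. \<delta> ^ n * norm x) \<longlonglongrightarrow> 0"
          using \<delta> by (intro tendsto_mult_left_zero LIMSEQ_realpow_zero)
      qed
      then have "(\<lambda>n. x - (R ^^ n) x) \<longlonglongrightarrow> x - 0"
        by (intro tendsto_intros)
      ultimately show ?thesis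
        using LIMSEQ_unique by fastforce
    qed
    fix p :: "'y \<Rightarrow> real" and a x
    assume p: "continuous_on C p" "subadditive_on C p" "pos_homogeneous_on C p"
      and pF: "\<And>x. p (F x) \<le> a * norm x"
    have crude: "p (\<gamma> x) \<le> \<bar>a\<bar> / (1 - \<delta>) * norm x" for x
    proof (rule LIMSEQ_le_const2[OF along[OF p(1)]], intro exI allI impI)
      fix n
      have "p (\<Sum>i<n. F ((R ^^ i) x)) \<le> (\<Sum>i<n. p (F ((R ^^ i) x)))"
      proof (induction n)
        case (Suc n)
        have "p ((\<Sum>i<n. F ((R ^^ i) x)) + F ((R ^^ n) x))
            \<le> p (\<Sum>i<n. F ((R ^^ i) x)) + p (F ((R ^^ n) x))"
          using p(2) partC FC unfolding subadditive_on_def by blast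
        with Suc show ?case
          by simp
      qed (simp add: zero[OF p(3)])
      also have "\<dots> \<le> (\<Sum>i<n. \<bar>a\<bar> * norm x * \<delta> ^ i)"
      proof (rule sum_mono)
        fix i
        have "p (F ((R ^^ i) x)) \<le> a * norm ((R ^^ i) x)"
          by (rule pF)
        also have "\<dots> \<le> \<bar>a\<bar> * (\<delta> ^ i * norm x)"
          using R_norm[of i x] by (intro mult_mono) auto
        finally show "p (F ((R ^^ i) x)) \<le> \<bar>a\<bar> * norm x * \<delta> ^ i"
          by (simp add: mult_ac)
      qed
      also have "\<dots> \<le> (\<Sum>i. \<bar>a\<bar> * norm x * \<delta> ^ i)"
        using \<delta> by (intro sum_le_suminf summable_mult[OF geo]) auto
      also have "\<dots> = \<bar>a\<bar> / (1 - \<delta>) * norm x"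
        using \<delta> geo by (simp add: suminf_mult suminf_geometric)
      finally show "p (\<Sum>i<n. F ((R ^^ i) x)) \<le> \<bar>a\<bar> / (1 - \<delta>) * norm x" .
    qed
    have "p (\<gamma> x) \<le> p (F x) + p (\<gamma> (R x))"
      using p(2) FC \<gamma>C split[of x] unfolding subadditive_on_def by metis
    also have "\<dots> \<le> a * norm x + \<bar>a\<bar> / (1 - \<delta>) * norm (R x)"
      by (rule add_mono[OF pF crude])
    also have "\<dots> \<le> a * norm x + \<bar>a\<bar> / (1 - \<delta>) * (\<delta> * norm x)"
      using err[of x] \<delta> by (intro add_left_mono mult_left_mono) (auto simp: R_def)
    finally show "p (\<gamma> x) \<le> (a + \<bar>a\<bar> * \<delta> / (1 - \<delta>)) * norm x"
      by (simp add: algebra_simps)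
  qed
qed

section \<open>Continuous positively homogeneous right inverses\<close>

theorem theorem3p7:
  fixes C :: "'y::banach set"
    and T :: "'y \<Rightarrow> 'x::banach"
    and J :: "'j set"
    and \<rho> :: "'j \<Rightarrow> 'y \<Rightarrow> real"
    and \<alpha> :: "'j \<Rightarrow> real"
    and K :: real
  assumes "closed C" and "additive_cone C"
    and "T ` C = UNIV" and "continuous_on C T"
    and "additive_on C T" and "pos_homogeneous_on C T"
    and "finite J"
    and "\<And>j. j \<in> J \<Longrightarrow> continuous_on C (\<rho> j)"
    and "\<And>j. j \<in> J \<Longrightarrow> subadditive_on C (\<rho> j)"
    and "\<And>j. j \<in> J \<Longrightarrow> pos_homogeneous_on C (\<rho> j)"
    and "K > 0"
  shows
    "(\<forall>\<epsilon>>0. \<exists>\<gamma> :: 'x \<Rightarrow> 'y.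
        \<gamma> ` sphere 0 1 \<subseteq> C \<and>
        (\<forall>x\<in>sphere 0 1. T (\<gamma> x) = x) \<and>
        (\<forall>x\<in>sphere 0 1. norm (\<gamma> x) \<le> K + \<epsilon>) \<and>
        (\<forall>x\<in>sphere 0 1. \<forall>j\<in>J. \<rho> j (\<gamma> x) \<le> \<alpha> j + \<epsilon>))
     \<longleftrightarrow>
     (\<forall>\<epsilon>>0. \<exists>\<gamma> :: 'x \<Rightarrow> 'y.
        range \<gamma> \<subseteq> C \<and> continuous_on UNIV \<gamma> \<and> pos_homogeneous_on UNIV \<gamma> \<and>
        (\<forall>x. T (\<gamma> x) = x) \<and>
        (\<forall>x. norm (\<gamma> x) \<le> (K + \<epsilon>) * norm x) \<and>
        (\<forall>x. \<forall>j\<in>J. \<rho> j (\<gamma> x) \<le> (\<alpha> j + \<epsilon>) * norm x))"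
  (is "(\<forall>\<epsilon>>0. \<exists>\<gamma>. ?unit \<epsilon> \<gamma>) \<longleftrightarrow> (\<forall>\<epsilon>>0. \<exists>\<gamma>. ?cont \<epsilon> \<gamma>)")
proof (intro iffI allI impI)
  fix \<epsilon> :: real
  assume "\<forall>\<epsilon>>0. \<exists>\<gamma>. ?cont \<epsilon> \<gamma>" and "\<epsilon> > 0"
  then obtain \<gamma> where "?cont \<epsilon> \<gamma>"
    by blast
  then have "?unit \<epsilon> \<gamma>"
    by (auto simp: image_subset_iff) (metis mult.right_neutral)+
  then show "\<exists>\<gamma>. ?unit \<epsilon> \<gamma>"
    by (intro exI[of _ \<gamma>])
next
  fix \<epsilon> :: real
  assume unit: "\<forall>\<epsilon>>0. \<exists>\<gamma>. ?unit \<epsilon> \<gamma>" and "\<epsilon> > 0"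
  note C = assms(1,2) and T = assms(4-6)
  (* M bounds every constant to which the iteration is applied, so that one \<delta> serves all. *)
  define M where "M = K + (\<Sum>j\<in>J. \<bar>\<alpha> j\<bar>) + \<epsilon>"
  have M_K: "\<bar>K + \<epsilon> / 2\<bar> \<le> M"
    using \<open>K > 0\<close> \<open>\<epsilon> > 0\<close> by (auto simp: M_def intro: sum_nonneg add_mono)
  have M_\<alpha>: "\<bar>\<alpha> j + \<epsilon> / 2\<bar> \<le> M" if "j \<in> J" for j
    using member_le_sum[OF that, of "\<lambda>j. \<bar>\<alpha> j\<bar>"] \<open>finite J\<close> \<open>K > 0\<close> \<open>\<epsilon> > 0\<close>
    by (auto simp: M_def)
  have "M > 0"
    using M_K \<open>K > 0\<close> \<open>\<epsilon> > 0\<close> by linarith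
  define \<delta> where "\<delta> = min (1 / 2) (\<epsilon> / (4 * M))"
  have \<delta>: "0 < \<delta>" "\<delta> < 1" "\<delta> \<le> 1 / 2" "\<delta> * M \<le> \<epsilon> / 4"
    using \<open>M > 0\<close> \<open>\<epsilon> > 0\<close> by (auto simp: \<delta>_def min_def field_simps)
  (* The averaged map has the bounds with \<epsilon> / 2 added; the tail of the series may use the
     other \<epsilon> / 2. *)
  have slack: "a + \<epsilon> / 2 + \<bar>a + \<epsilon> / 2\<bar> * \<delta> / (1 - \<delta>) \<le> a + \<epsilon>" if "\<bar>a + \<epsilon> / 2\<bar> \<le> M" for a
  proof -
    have "\<bar>a + \<epsilon> / 2\<bar> * \<delta> \<le> M * \<delta>"
      using that \<delta> by (intro mult_right_mono) auto
    also have "\<dots> \<le> \<epsilon> / 4"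
      using \<delta> by (simp add: mult.commute)
    also have "\<dots> \<le> \<epsilon> / 2 * (1 - \<delta>)"
      using \<delta> \<open>\<epsilon> > 0\<close> by (simp add: field_simps)
    finally show ?thesis
      using \<delta> by (simp add: field_simps)
  qed
  obtain \<gamma>\<^sub>0 where \<gamma>\<^sub>0: "?unit (\<epsilon> / 2) \<gamma>\<^sub>0"
    using unit \<open>\<epsilon> > 0\<close> half_gt_zero by blast
  have norm: "continuous_on C norm" "subadditive_on C norm" "pos_homogeneous_on C norm"
    by (auto simp: subadditive_on_def pos_homogeneous_on_def norm_triangle_ineq
        intro: continuous_intros)
  have "0 \<in> C"
  proof -
    obtain u where "u \<in> C"
      using assms(3) by blast
    then show ?thesis
      using C(2) unfolding additive_cone_def by (metis order_refl scaleR_zero_left)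
  qed
  moreover have "bounded (\<gamma>\<^sub>0 ` sphere 0 1)"
    using \<gamma>\<^sub>0 by (auto simp: bounded_iff)
  ultimately obtain F where F: "range F \<subseteq> C" "continuous_on UNIV F" "pos_homogeneous_on UNIV F"
    and err: "\<And>x. norm (x - T (F x)) \<le> \<delta> * norm x"
    and Fp: "\<And>p a x. \<lbrakk>continuous_on C p; subadditive_on C p; pos_homogeneous_on C p;
        \<And>x. x \<in> sphere 0 1 \<Longrightarrow> p (\<gamma>\<^sub>0 x) \<le> a\<rbrakk> \<Longrightarrow> p (F x) \<le> a * norm x"
    using continuous_approximate_right_inverse[OF C T _ \<delta>(1), of \<gamma>\<^sub>0] \<gamma>\<^sub>0
    by (smt (verit, best) image_subset_iff)
  have F_norm: "norm (F x) \<le> (K + \<epsilon> / 2) * norm x" for x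
    using Fp[OF norm] \<gamma>\<^sub>0 by blast
  obtain \<gamma> where \<gamma>: "range \<gamma> \<subseteq> C" "continuous_on UNIV \<gamma>" "pos_homogeneous_on UNIV \<gamma>"
      "\<And>x. T (\<gamma> x) = x"
    and \<gamma>p: "\<And>p a x. \<lbrakk>continuous_on C p; subadditive_on C p; pos_homogeneous_on C p;
        \<And>x. p (F x) \<le> a * norm x\<rbrakk>
      \<Longrightarrow> p (\<gamma> x) \<le> (a + \<bar>a\<bar> * \<delta> / (1 - \<delta>)) * norm x"
    using approximate_right_inverse_iteration[OF C T F F_norm err _ \<delta>(2)] \<delta>(1)
    by (metis less_imp_le)
  have final: "p (\<gamma> x) \<le> (a + \<epsilon>) * norm x"
    if p: "continuous_on C p" "subadditive_on C p" "pos_homogeneous_on C p"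
      and "\<And>x. x \<in> sphere 0 1 \<Longrightarrow> p (\<gamma>\<^sub>0 x) \<le> a + \<epsilon> / 2" and "\<bar>a + \<epsilon> / 2\<bar> \<le> M" for p a x
  proof -
    have "p (\<gamma> x) \<le> (a + \<epsilon> / 2 + \<bar>a + \<epsilon> / 2\<bar> * \<delta> / (1 - \<delta>)) * norm x"
      by (rule \<gamma>p[OF p Fp[OF p that(4)]])
    also have "\<dots> \<le> (a + \<epsilon>) * norm x"
      using slack[OF that(5)] by (intro mult_right_mono) auto
    finally show ?thesis .
  qed
  have "norm (\<gamma> x) \<le> (K + \<epsilon>) * norm x" for x
    using final[OF norm _ M_K] \<gamma>\<^sub>0 by blast
  moreover have "\<rho> j (\<gamma> x) \<le> (\<alpha> j + \<epsilon>) * norm x" if "j \<in> J" for j x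
    using final[OF assms(8-10)[OF that] _ M_\<alpha>[OF that]] \<gamma>\<^sub>0 that by blast
  ultimately have "?cont \<epsilon> \<gamma>"
    using \<gamma> by blast
  then show "\<exists>\<gamma>. ?cont \<epsilon> \<gamma>"
    by (intro exI[of _ \<gamma>])
qed

end
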